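(* Let $\varepsilon \in (0,1)$, and let $n$ be a (positive) integer satisfying $$\lceil (\log(n)+1)^2 \rceil < \lceil n^\varepsilon \rceil \le n - 2\lceil\log(n)\rceil .$$ Let $p(n,\varepsilon)$ denote the proportion of elements $g$ in the symmetric group $S_n$ such that $g$ has even order and $g^{|g|/2}$ is an involution whose support has cardinality at most $\lceil n^\varepsilon \rceil$, and let $\tilde{p}(n,\varepsilon)$ denote the corresponding proportion of elements in the alternating group $A_n$ (that is, the number of $g\in A_n$ with the same property, divided by $|A_n|$). Then $$p(n,\varepsilon) > \frac{\varepsilon}{48} \quad\text{and}\quad \tilde{p}(n,\varepsilon) > \frac{\varepsilon}{96}.$$
   Context: Here $\log$ is the natural logarithm and $\varepsilon$ is a real number. For a group element $g$, $|g|$ denotes its order; an involution is an element of order $2$. The support of a permutation in $S_n$ is the set of points of $\{1,\dots,n\}$ that it moves. The proportion of elements of a finite group $G$ with a given property is the number of elements of $G$ with that property divided by $|G|$. *)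

theory Defs
  imports Complex_Main "HOL-Algebra.Sym_Groups" "HOL-Algebra.Multiplicative_Group"
begin

definition proportion :: "('a, 'b) monoid_scheme \<Rightarrow> ('a \<Rightarrow> bool) \<Rightarrow> real" where
  "proportion G P = real (card {g \<in> carrier G. P g}) / real (order G)"

definition involution :: "('a, 'b) monoid_scheme \<Rightarrow> 'a \<Rightarrow> bool" where
  "involution G x \<longleftrightarrow> x \<in> carrier G \<and> group.ord G x = 2"

text \<open>A permutation of \<open>{1..n}\<close> is represented by a function on all of \<^typ>\<open>nat\<close> that is the
  identity off \<open>{1..n}\<close>, so all moved points lie in \<open>{1..n}\<close>.  (The abbreviation \<open>support\<close> of
  \<^theory>\<open>HOL-Combinatorics.Cycles\<close> is a single orbit, not this set.)\<close>

definition perm_support :: "('a \<Rightarrow> 'a) \<Rightarrow> 'a set" where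
  "perm_support p = {i. p i \<noteq> i}"

definition powers_to_small_involution :: "(nat \<Rightarrow> nat) monoid \<Rightarrow> int \<Rightarrow> (nat \<Rightarrow> nat) \<Rightarrow> bool" where
  "powers_to_small_involution G k g \<longleftrightarrow>
     even (group.ord G g) \<and>
     involution G (g [^]\<^bsub>G\<^esub> (group.ord G g div 2)) \<and>
     int (card (perm_support (g [^]\<^bsub>G\<^esub> (group.ord G g div 2)))) \<le> k"

definition p_sym :: "nat \<Rightarrow> real \<Rightarrow> real" where
  "p_sym n \<epsilon> =
     proportion (sym_group n) (powers_to_small_involution (sym_group n) \<lceil>real n powr \<epsilon>\<rceil>)"

definition p_alt :: "nat \<Rightarrow> real \<Rightarrow> real" where
  "p_alt n \<epsilon> =
     proportion (alt_group n) (powers_to_small_involution (alt_group n) \<lceil>real n powr \<epsilon>\<rceil>)"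

end

theory Submission
  imports Defs
begin

text \<open>
  Let \<open>L = ln n\<close>, \<open>k = \<lceil>n powr \<epsilon>\<rceil>\<close>, and choose \<open>d = 2 ^ a\<close> with \<open>L \<le> d < 2 * L\<close>.  If the points of \<open>g\<close>
  lying on cycles of length divisible by \<open>d\<close> number between \<open>1\<close> and \<open>k\<close>, then \<open>\<bar>g\<bar>\<close> is even and the
  involution \<open>g ^ (\<bar>g\<bar> / 2)\<close> moves only such points.  It suffices to count the \<open>g\<close> with exactly one
  cycle of length divisible by \<open>d\<close>, that length \<open>m\<close> being at most \<open>k\<close>: for given \<open>m\<close> their proportion
  is \<open>s (n - m) / m\<close>, where \<open>s N\<close> is the proportion of elements of the symmetric group of degree
  \<open>N\<close> without a cycle of length divisible by \<open>d\<close>.  As \<open>d \<ge> L\<close>, all these \<open>s\<close> are at least \<open>1 / 4\<close>,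
  and the sum of \<open>1 / m\<close> over the multiples \<open>m \<le> k\<close> of \<open>d\<close> is at least \<open>ln (k / d) / d\<close>.
  For even \<open>g\<close> the part off the long cycle must be odd, and at least a quarter of the permutations
  counted by \<open>s N\<close> have any prescribed parity when \<open>N \<ge> 2\<close>.
\<close>

section \<open>Removing the cycle through a point\<close>

lemma least_power_cong:
  assumes "\<And>i. (f ^^ i) x = x \<longleftrightarrow> (g ^^ i) y = y"
  shows "least_power f x = least_power g y"
  using assms by (simp add: least_power_def)

lemma cycle_of_list_funpow_nth:
  assumes "distinct cs" "j < length cs"
  shows "(cycle_of_list cs ^^ i) (cs ! j) = cs ! ((i + j) mod length cs)"
proof -
  have "(cycle_of_list cs ^^ i) (cs ! j) = map (cycle_of_list cs ^^ i) cs ! j"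
    using assms by simp
  also have "\<dots> = rotate i cs ! j"
    using cyclic_rotation[OF assms(1)] by simp
  finally show ?thesis
    using assms by (simp add: nth_rotate)
qed

text \<open>Each recursion step of \<open>cycle_of_list\<close> splits off one transposition, so a
  cycle of length l is a product of l - 1 of them.\<close>

lemma evenperm_cycle_of_list:
  assumes "distinct cs" "cs \<noteq> []"
  shows "evenperm (cycle_of_list cs) \<longleftrightarrow> odd (length cs)"
  using assms
proof (induction cs rule: cycle_of_list.induct)
  case (1 i j cs)
  then show ?case
    by (auto simp: evenperm_comp permutation_swap_id permutation_of_cycle evenperm_swap
             simp del: comp_apply)
qed auto

text \<open>Fixing \<open>a\<close> as the head makes each cycle through \<open>a\<close> correspond
  to exactly one list; \<open>[a]\<close> stands for the case that \<open>a\<close> is a fixed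
  point.\<close>

definition cycles_through :: "'a \<Rightarrow> 'a set \<Rightarrow> 'a list set" where
  "cycles_through a A = {cs. cs \<noteq> [] \<and> hd cs = a \<and> distinct cs \<and> set cs \<subseteq> A}"

lemma finite_cycles_through: "finite A \<Longrightarrow> finite (cycles_through a A)"
  by (rule finite_subset[OF _ finite_subset_distinct[of A]]) (auto simp: cycles_through_def)

lemma length_cycles_through:
  assumes "finite A" "cs \<in> cycles_through a A"
  shows "length cs \<in> {1..card A}"
  using assms card_mono[of A "set cs"]
  by (auto simp: cycles_through_def distinct_card Suc_le_eq)

text \<open>The tail is an ordered choice of \<open>l - 1\<close> of the other points, which gives
  (N - 1)! / (N - l)! lists for N = \<open>card A\<close>.\<close>

lemma card_cycles_through:
  assumes "finite A" "a \<in> A" "l \<in> {1..card A}"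
  shows "card {cs \<in> cycles_through a A. length cs = l} * fact (card A - l) = (fact (card A - 1) :: nat)"
proof -
  let ?X = "{xs. length xs = l - 1 \<and> distinct xs \<and> set xs \<subseteq> A - {a}}"
  have "{cs \<in> cycles_through a A. length cs = l} = (#) a ` ?X"
  proof (intro equalityI subsetI)
    fix cs assume "cs \<in> {cs \<in> cycles_through a A. length cs = l}"
    then show "cs \<in> (#) a ` ?X"
      by (cases cs) (auto simp: cycles_through_def)
  next
    fix cs assume "cs \<in> (#) a ` ?X"
    then show "cs \<in> {cs \<in> cycles_through a A. length cs = l}"
      using assms by (auto simp: cycles_through_def)
  qed
  then have "card {cs \<in> cycles_through a A. length cs = l} = card ?X"
    by (simp add: card_image)
  also have "\<dots> = \<Prod>{card (A - {a}) - (l - 1) + 1..card (A - {a})}"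
    using assms by (intro card_lists_distinct_length_eq) auto
  also have "\<dots> = \<Prod>{Suc (card A - l)..card A - 1}"
    using assms by (auto simp: Suc_diff_Suc intro!: arg_cong[where f = Prod])
  finally have eq: "card {cs \<in> cycles_through a A. length cs = l} = \<Prod>{Suc (card A - l)..card A - 1}" .
  have "{1..card A - 1} = {1..card A - l} \<union> {Suc (card A - l)..card A - 1}"
    using assms by auto
  then have "(fact (card A - 1) :: nat) = \<Prod>({1..card A - l} \<union> {Suc (card A - l)..card A - 1})"
    by (simp add: fact_prod)
  also have "\<dots> = \<Prod>{1..card A - l} * \<Prod>{Suc (card A - l)..card A - 1}"
    by (rule prod.union_disjoint) auto
  finally show ?thesis
    by (simp add: eq fact_prod)
qed

text \<open>Every length l receives the same weight (N - 1)!: the cycle through \<open>a\<close> in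
  a random permutation is equally likely to have any length. This turns counts over cycles into
  recursions for proportions.\<close>

lemma sum_cycles_through:
  fixes y :: "nat \<Rightarrow> real"
  assumes "finite A" "a \<in> A"
  shows "(\<Sum>cs\<in>cycles_through a A. fact (card A - length cs) * y (length cs)) =
    fact (card A - 1) * (\<Sum>l = 1..card A. y l)"
proof -
  have "(\<Sum>cs\<in>cycles_through a A. fact (card A - length cs) * y (length cs)) =
    (\<Sum>l = 1..card A. \<Sum>cs\<in>{cs \<in> cycles_through a A. length cs = l}.
       fact (card A - length cs) * y (length cs))"
    using length_cycles_through[OF assms(1)]
    by (intro sum.group[symmetric] finite_cycles_through assms) auto
  also have "\<dots> = (\<Sum>l = 1..card A. fact (card A - 1) * y l)"
  proof (rule sum.cong[OF refl])
    fix l assume l: "l \<in> {1..card A}"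
    have "(\<Sum>cs\<in>{cs \<in> cycles_through a A. length cs = l}. fact (card A - length cs) * y (length cs)) =
      real (card {cs \<in> cycles_through a A. length cs = l} * fact (card A - l)) * y l"
      by simp
    then show "(\<Sum>cs\<in>{cs \<in> cycles_through a A. length cs = l}. fact (card A - length cs) * y (length cs)) =
      fact (card A - 1) * y l"
      by (simp only: card_cycles_through[OF assms l] of_nat_fact)
  qed
  finally show ?thesis
    by (simp add: sum_distrib_left)
qed

context
  fixes cs :: "'a list" and r :: "'a \<Rightarrow> 'a"
  assumes cs: "distinct cs" and r: "\<And>x. x \<in> set cs \<Longrightarrow> r x = x" and inj: "inj r"
begin

lemma cycle_comp_funpow_in:
  assumes "x \<in> set cs"
  shows "((cycle_of_list cs \<circ> r) ^^ i) x = (cycle_of_list cs ^^ i) x"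
proof (induction i)
  case (Suc i)
  have "(cycle_of_list cs ^^ i) x \<in> set cs"
    using assms permutes_in_image[OF permutes_funpow[OF cycle_permutes]] by metis
  with Suc show ?case
    by (simp add: r)
qed simp

lemma cycle_comp_funpow_out:
  assumes "x \<notin> set cs"
  shows "((cycle_of_list cs \<circ> r) ^^ i) x = (r ^^ i) x"
proof (induction i)
  case (Suc i)
  \<comment> \<open>Since \<open>r\<close> is injective and fixes \<open>set cs\<close> pointwise,
    no orbit can enter \<open>set cs\<close> from outside.\<close>
  have "(r ^^ i) x \<notin> set cs" for i
    by (induction i) (use assms r inj in \<open>auto simp: inj_def, metis\<close>)
  from this[of "Suc i"] Suc show ?case
    by (simp add: id_outside_supp)
qed simp

lemma least_power_cycle_comp_in:
  assumes "x \<in> set cs"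
  shows "least_power (cycle_of_list cs \<circ> r) x = length cs"
proof -
  obtain j where j: "j < length cs" "x = cs ! j"
    using assms by (auto simp: in_set_conv_nth)
  have *: "((cycle_of_list cs \<circ> r) ^^ i) x = x \<longleftrightarrow> length cs dvd i" for i
  proof -
    have "((cycle_of_list cs \<circ> r) ^^ i) x = x \<longleftrightarrow> cs ! ((i + j) mod length cs) = cs ! j"
      using j cycle_comp_funpow_in[OF assms] by (simp add: cycle_of_list_funpow_nth cs)
    also have "\<dots> \<longleftrightarrow> (i + j) mod length cs = j mod length cs"
      using cs j by (subst nth_eq_iff_index_eq) (auto intro: mod_less_divisor)
    also have "\<dots> \<longleftrightarrow> length cs dvd i"
      by (simp add: mod_eq_dvd_iff_nat)
    finally show ?thesis .
  qed
  show ?thesis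
    unfolding least_power_def *
    by (rule Least_equality) (use j in \<open>auto dest: dvd_imp_le\<close>)
qed

lemma least_power_cycle_comp_out:
  assumes "x \<notin> set cs"
  shows "least_power (cycle_of_list cs \<circ> r) x = least_power r x"
  by (rule least_power_cong) (simp add: cycle_comp_funpow_out assms)

text \<open>The list of iterates of \<open>hd cs\<close> recovers \<open>cs\<close> from the
  product; injectivity of the decomposition rests on this.\<close>

lemma support_cycle_comp:
  assumes "cs \<noteq> []"
  shows "support (cycle_of_list cs \<circ> r) (hd cs) = cs"
proof (rule nth_equalityI)
  have a: "hd cs \<in> set cs" "hd cs = cs ! 0"
    using assms by (auto simp: hd_conv_nth)
  show len: "length (support (cycle_of_list cs \<circ> r) (hd cs)) = length cs"
    using a by (simp add: least_power_cycle_comp_in)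
  fix i assume "i < length (support (cycle_of_list cs \<circ> r) (hd cs))"
  then show "support (cycle_of_list cs \<circ> r) (hd cs) ! i = cs ! i"
    using a len assms cs cycle_of_list_funpow_nth[of cs 0 i] by (simp add: cycle_comp_funpow_in)
qed

end

text \<open>A permutation \<open>p\<close> of \<open>A\<close> splits uniquely into its cycle
  through \<open>a\<close> and a permutation of the remaining points: the cycle is read off as
  \<open>support p a\<close>, and cancelling it from \<open>p\<close> leaves the rest.\<close>

lemma bij_betw_cycle_comp:
  assumes "finite A" "a \<in> A"
  shows "bij_betw (\<lambda>(cs, r). cycle_of_list cs \<circ> r)
    (SIGMA cs:cycles_through a A. {r. r permutes A - set cs}) {p. p permutes A}"
  unfolding bij_betw_def
proof
  have perm: "r x = x" "inj r" if "r permutes A - set cs" "x \<in> set cs" for cs x and r :: "'a \<Rightarrow> 'a"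
    using that by (auto intro: permutes_inj permutes_not_in)
  show "inj_on (\<lambda>(cs, r). cycle_of_list cs \<circ> r)
    (SIGMA cs:cycles_through a A. {r. r permutes A - set cs})"
  proof (rule inj_onI; clarify)
    fix cs r cs' r'
    assume *: "cs \<in> cycles_through a A" "cs' \<in> cycles_through a A"
      "r permutes A - set cs" "r' permutes A - set cs'"
      and eq: "cycle_of_list cs \<circ> r = cycle_of_list cs' \<circ> r'"
    have "cs = support (cycle_of_list cs \<circ> r) a" "cs' = support (cycle_of_list cs' \<circ> r') a"
      using support_cycle_comp[of cs r] support_cycle_comp[of cs' r'] * perm(1)
        permutes_inj[OF *(3)] permutes_inj[OF *(4)]
      by (simp_all add: cycles_through_def)
    then have "cs = cs'"
      using eq by metis
    moreover from this have "r = r'"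
      using eq permutes_inj[OF cycle_permutes[of cs]] by (auto simp: fun_eq_iff dest: injD)
    ultimately show "cs = cs' \<and> r = r'" ..
  qed
  show "(\<lambda>(cs, r). cycle_of_list cs \<circ> r) `
    (SIGMA cs:cycles_through a A. {r. r permutes A - set cs}) = {p. p permutes A}"
  proof (intro equalityI subsetI)
    fix p assume "p \<in> (\<lambda>(cs, r). cycle_of_list cs \<circ> r) `
      (SIGMA cs:cycles_through a A. {r. r permutes A - set cs})"
    then obtain cs r where *: "cs \<in> cycles_through a A" "r permutes A - set cs"
      "p = cycle_of_list cs \<circ> r"
      by auto
    have "cycle_of_list cs permutes A"
      using * permutes_subset[OF cycle_permutes] by (auto simp: cycles_through_def)
    moreover have "r permutes A"
      using * permutes_subset by blast
    ultimately show "p \<in> {p. p permutes A}"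
      using * permutes_compose by auto
  next
    fix p assume "p \<in> {p. p permutes A}"
    then have p: "p permutes A" and perm: "permutation p"
      using assms permutes_imp_permutation by auto
    define cs where "cs = support p a"
    define c where "c = cycle_of_list cs"
    define r where "r = inv' c \<circ> p"
    have pos: "least_power p a > 0"
      using least_power_of_permutation(2)[OF perm] .
    have "(p ^^ i) a \<in> A" for i
      using permutes_in_image[OF permutes_funpow[OF p]] assms(2) by metis
    then have cs: "cs \<in> cycles_through a A"
      using cycle_of_permutation[OF perm, of a] pos
      unfolding cs_def cycles_through_def by (auto simp: hd_map)
    have c: "c permutes set cs" "c permutes A"
      using cs permutes_subset[OF cycle_permutes[of cs]]
      by (auto simp: c_def cycle_permutes cycles_through_def)
    have "r permutes A"
      unfolding r_def using c p by (intro permutes_compose permutes_inv)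
    moreover have "r x = x" if "x \<in> set cs" for x
      using cycle_restrict[OF perm, of x a] that permutes_inverses(2)[OF c(1)]
      by (simp add: r_def c_def cs_def)
    ultimately have "r permutes A - set cs"
      by (rule permutes_superset) auto
    moreover have "p = c \<circ> r"
      using permutes_inv_o(1)[OF c(1)] by (simp add: r_def o_assoc)
    ultimately show "p \<in> (\<lambda>(cs, r). cycle_of_list cs \<circ> r) `
      (SIGMA cs:cycles_through a A. {r. r permutes A - set cs})"
      using cs by (auto simp: c_def)
  qed
qed

lemma card_permutes_by_cycle:
  assumes "finite A" "a \<in> A"
  shows "card {p. p permutes A \<and> P p} =
    (\<Sum>cs\<in>cycles_through a A. card {r. r permutes A - set cs \<and> P (cycle_of_list cs \<circ> r)})"
proof -
  let ?f = "\<lambda>(cs, r). cycle_of_list cs \<circ> r"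
  let ?S = "SIGMA cs:cycles_through a A. {r. r permutes A - set cs \<and> P (cycle_of_list cs \<circ> r)}"
  have "?S \<subseteq> (SIGMA cs:cycles_through a A. {r. r permutes A - set cs})"
    by auto
  moreover have "?f ` ?S = {p. p permutes A \<and> P p}"
  proof (intro equalityI subsetI)
    fix p assume "p \<in> ?f ` ?S"
    then obtain cs r where csr: "cs \<in> cycles_through a A" "r permutes A - set cs"
      "P (cycle_of_list cs \<circ> r)" "p = cycle_of_list cs \<circ> r"
      by auto
    then have "p \<in> {p. p permutes A}"
      unfolding bij_betw_imp_surj_on[OF bij_betw_cycle_comp[OF assms], symmetric] by auto
    with csr show "p \<in> {p. p permutes A \<and> P p}"
      by simp
  next
    fix p assume p: "p \<in> {p. p permutes A \<and> P p}"
    then have "p \<in> ?f ` (SIGMA cs:cycles_through a A. {r. r permutes A - set cs})"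
      unfolding bij_betw_imp_surj_on[OF bij_betw_cycle_comp[OF assms]] by auto
    with p show "p \<in> ?f ` ?S"
      by auto
  qed
  ultimately have "card ?S = card {p. p permutes A \<and> P p}"
    by (intro bij_betw_same_card[OF bij_betw_subset[OF bij_betw_cycle_comp[OF assms]]])
  moreover have "card ?S =
    (\<Sum>cs\<in>cycles_through a A. card {r. r permutes A - set cs \<and> P (cycle_of_list cs \<circ> r)})"
    using assms finite_permutations[of "A - set _"]
    by (intro card_SigmaI finite_cycles_through ballI) (auto intro: finite_subset)
  ultimately show ?thesis
    by simp
qed

section \<open>Permutations with few points on long cycles\<close>

text \<open>\<^const>\<open>least_power\<close> \<open>p x\<close> is the length of the cycle of \<open>p\<close> through \<open>x\<close>; it is \<open>1\<close> at fixed points.\<close>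

definition long_points :: "nat \<Rightarrow> ('a \<Rightarrow> 'a) \<Rightarrow> 'a set" where
  "long_points d p = {x. d dvd least_power p x}"

lemma least_power_fixed: "p x = x \<Longrightarrow> least_power p x = 1"
  unfolding least_power_def by (rule Least_equality) auto

text \<open>A point outside \<open>A\<close> is fixed, so its cycle length is 1, which
  \<open>d > 1\<close> does not divide.\<close>

lemma long_points_subset:
  assumes "d > 1" "p permutes A"
  shows "long_points d p \<subseteq> A"
  using assms least_power_fixed[of p] permutes_not_in[OF assms(2)]
  by (force simp: long_points_def)

lemma long_points_cycle_comp:
  assumes "d > 1" "distinct cs" "r permutes A - set cs"
  shows "long_points d (cycle_of_list cs \<circ> r) =
    (if d dvd length cs then set cs else {}) \<union> long_points d r"
proof -
  have r: "r x = x" if "x \<in> set cs" for x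
    using assms(3) that by (auto intro: permutes_not_in)
  have "long_points d r \<inter> set cs = {}"
    using long_points_subset[OF assms(1,3)] by auto
  then have "x \<in> long_points d (cycle_of_list cs \<circ> r) \<longleftrightarrow>
      x \<in> (if d dvd length cs then set cs else {}) \<union> long_points d r" for x
    using least_power_cycle_comp_in[OF assms(2) r permutes_inj[OF assms(3)]]
      least_power_cycle_comp_out[OF assms(2) r permutes_inj[OF assms(3)]]
    by (cases "x \<in> set cs") (auto simp: long_points_def)
  then show ?thesis
    by blast
qed

lemma evenperm_cycle_comp:
  assumes "finite A" "cs \<in> cycles_through a A" "r permutes A - set cs"
  shows "evenperm (cycle_of_list cs \<circ> r) \<longleftrightarrow> evenperm r = odd (length cs)"
proof -
  have "permutation r"
    using assms permutes_imp_permutation by blast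
  then show ?thesis
    using assms
    by (auto simp: evenperm_comp permutation_of_cycle evenperm_cycle_of_list cycles_through_def)
qed

definition short_perms :: "nat \<Rightarrow> bool \<Rightarrow> 'a set \<Rightarrow> ('a \<Rightarrow> 'a) set" where
  "short_perms d b A = {p. p permutes A \<and> long_points d p = {} \<and> evenperm p = b}"

text \<open>The long points may lie on several cycles. Only their number matters later, because the
  involution moves none but long points.\<close>

definition few_long_perms :: "nat \<Rightarrow> nat \<Rightarrow> bool \<Rightarrow> 'a set \<Rightarrow> ('a \<Rightarrow> 'a) set" where
  "few_long_perms d k b A =
     {p. p permutes A \<and> long_points d p \<noteq> {} \<and> card (long_points d p) \<le> k \<and> evenperm p = b}"

text \<open>The recursion removes the cycle of length \<open>l\<close> through a chosen point; the flag \<open>b\<close> is the parity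
  (\<^const>\<open>True\<close> for even), which a cycle of even length flips.\<close>

fun short_prop :: "nat \<Rightarrow> bool \<Rightarrow> nat \<Rightarrow> real" where
  "short_prop d b N = (if N = 0 then of_bool b else
     (\<Sum>l\<in>{l \<in> {1..N}. \<not> d dvd l}. short_prop d (b = odd l) (N - l)) / N)"

declare short_prop.simps [simp del]

lemma short_prop_0 [simp]: "short_prop d b 0 = of_bool b"
  by (simp add: short_prop.simps)

lemma short_prop_rec:
  "real N * short_prop d b N = (\<Sum>l\<in>{l \<in> {1..N}. \<not> d dvd l}. short_prop d (b = odd l) (N - l))"
  by (simp add: short_prop.simps[of d b N])

lemma short_perms_by_cycle:
  assumes "d > 1" "finite A" "a \<in> A"
  shows "card (short_perms d b A) =
    (\<Sum>cs\<in>cycles_through a A. if d dvd length cs then 0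
       else card (short_perms d (b = odd (length cs)) (A - set cs)))"
  unfolding short_perms_def card_permutes_by_cycle[OF assms(2,3)]
proof (rule sum.cong[OF refl])
  fix cs assume cs: "cs \<in> cycles_through a A"
  then have "distinct cs" "cs \<noteq> []"
    by (auto simp: cycles_through_def)
  then have "{r. r permutes A - set cs \<and> long_points d (cycle_of_list cs \<circ> r) = {} \<and>
      evenperm (cycle_of_list cs \<circ> r) = b} =
    (if d dvd length cs then {} else {r. r permutes A - set cs \<and> long_points d r = {} \<and>
      evenperm r = (b = odd (length cs))})"
    using long_points_cycle_comp[OF assms(1), of cs _ A] evenperm_cycle_comp[OF assms(2) cs]
    by auto
  then show "card {r. r permutes A - set cs \<and> long_points d (cycle_of_list cs \<circ> r) = {} \<and>
      evenperm (cycle_of_list cs \<circ> r) = b} =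
    (if d dvd length cs then 0 else card {p. p permutes A - set cs \<and> long_points d p = {} \<and>
      evenperm p = (b = odd (length cs))})"
    by simp
qed

lemma card_Diff_cycle:
  assumes "finite A" "cs \<in> cycles_through a A"
  shows "card (A - set cs) = card A - length cs" "card (A - set cs) < card A"
  using assms length_cycles_through[OF assms]
  by (auto simp: cycles_through_def card_Diff_subset distinct_card)

lemma fact_mult_pred: "N > 0 \<Longrightarrow> fact (N - 1) * (real N * x) = fact N * x"
  by (simp add: fact_reduce)

lemma sum_if_not_dvd:
  fixes f :: "nat \<Rightarrow> real"
  shows "(\<Sum>l = 1..N. if d dvd l then 0 else f l) = (\<Sum>l\<in>{l \<in> {1..N}. \<not> d dvd l}. f l)"
  by (subst sum.inter_filter) (auto intro!: sum.cong)

text \<open>Removing the cycle through a point gives the count the recursion that defines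
  \<open>short_prop\<close>, which is therefore the proportion of permutations of parity
  \<open>b\<close> without a long cycle.\<close>

lemma card_short_perms:
  assumes "d > 1" "finite A"
  shows "real (card (short_perms d b A)) = fact (card A) * short_prop d b (card A)"
  using assms(2)
proof (induction "card A" arbitrary: A b rule: less_induct)
  case less
  show ?case
  proof (cases "A = {}")
    case True
    have "long_points d (id :: 'a \<Rightarrow> 'a) = {}"
      using long_points_subset[OF assms(1), of id "{}"] by simp
    then have "short_perms d b A = (if b then {id} else {})"
      using True by (auto simp: short_perms_def permutes_empty)
    then show ?thesis
      using True by simp
  next
    case False
    then obtain a where a: "a \<in> A"
      by blast
    let ?N = "card A"
    let ?y = "\<lambda>l. if d dvd l then 0 else short_prop d (b = odd l) (?N - l)"
    have "real (card (short_perms d b A)) =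
      (\<Sum>cs\<in>cycles_through a A. fact (?N - length cs) * ?y (length cs))"
      unfolding short_perms_by_cycle[OF assms(1) less.prems a] of_nat_sum
    proof (rule sum.cong[OF refl])
      fix cs assume cs: "cs \<in> cycles_through a A"
      show "real (if d dvd length cs then 0
          else card (short_perms d (b = odd (length cs)) (A - set cs))) =
        fact (?N - length cs) * ?y (length cs)"
        using less.hyps[OF card_Diff_cycle(2)[OF less.prems cs]] card_Diff_cycle(1)[OF less.prems cs]
          less.prems by simp
    qed
    also have "\<dots> = fact (?N - 1) * (\<Sum>l = 1..?N. ?y l)"
      by (rule sum_cycles_through[OF less.prems a])
    also have "\<dots> = fact ?N * short_prop d b ?N"
      using False less.prems
      by (simp only: sum_if_not_dvd short_prop_rec[symmetric] fact_mult_pred card_gt_0_iff simp_thms)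
    finally show ?thesis .
  qed
qed

text \<open>Only an inequality, since long points outside a long cycle through \<open>a\<close> are discarded.\<close>

lemma few_long_perms_by_cycle:
  assumes "d > 1" "even d" "finite A" "a \<in> A"
  shows "card (few_long_perms d k b A) \<ge>
    (\<Sum>cs\<in>cycles_through a A. if d dvd length cs
       then (if length cs \<le> k then card (short_perms d (\<not> b) (A - set cs)) else 0)
       else card (few_long_perms d k (b = odd (length cs)) (A - set cs)))"
  unfolding few_long_perms_def card_permutes_by_cycle[OF assms(3,4)]
proof (rule sum_mono)
  fix cs assume cs: "cs \<in> cycles_through a A"
  then have ds: "distinct cs" "cs \<noteq> []"
    by (auto simp: cycles_through_def)
  let ?R = "{r. r permutes A - set cs \<and> long_points d (cycle_of_list cs \<circ> r) \<noteq> {} \<and>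
      card (long_points d (cycle_of_list cs \<circ> r)) \<le> k \<and> evenperm (cycle_of_list cs \<circ> r) = b}"
  have fin: "finite ?R"
    using assms(3) finite_permutations[of "A - set cs"] by (auto intro: finite_subset)
  note long = long_points_cycle_comp[OF assms(1) ds(1), of _ A]
  note ev = evenperm_cycle_comp[OF assms(3) cs]
  show "(if d dvd length cs
       then (if length cs \<le> k then card (short_perms d (\<not> b) (A - set cs)) else 0)
       else card {p. p permutes A - set cs \<and> long_points d p \<noteq> {} \<and> card (long_points d p) \<le> k \<and>
         evenperm p = (b = odd (length cs))}) \<le> card ?R"
  proof (cases "d dvd length cs")
    case True
    then have "even (length cs)"
      using assms(2) by (rule dvd_trans[rotated])
    then have "length cs \<le> k \<Longrightarrow> short_perms d (\<not> b) (A - set cs) \<subseteq> ?R"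
      using True ds by (auto simp: short_perms_def long ev distinct_card)
    then show ?thesis
      using True card_mono[OF fin] by auto
  next
    case False
    then have "{p. p permutes A - set cs \<and> long_points d p \<noteq> {} \<and> card (long_points d p) \<le> k \<and>
         evenperm p = (b = odd (length cs))} = ?R"
      by (auto simp: long ev)
    with False show ?thesis
      by simp
  qed
qed

text \<open>For even \<open>d\<close>, the summand is the proportion of permutations of parity
  \<open>b\<close> with exactly one long cycle, of length m. That cycle is odd as a permutation, so
  the rest has parity \<open>\<not> b\<close>.\<close>

definition few_long_bound :: "nat \<Rightarrow> nat \<Rightarrow> bool \<Rightarrow> nat \<Rightarrow> real" where
  "few_long_bound d k b N =
     (\<Sum>m\<in>{m \<in> {1..N}. d dvd m \<and> m \<le> k}. short_prop d (\<not> b) (N - m) / m)"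

text \<open>Split the factor N of the m-th term as m + (N - m). The first part is the case that the
  removed cycle is the long one; the second unfolds by \<open>short_prop_rec\<close> into the
  removal of a short cycle.\<close>

lemma few_long_bound_rec:
  "real N * few_long_bound d k b N =
     (\<Sum>l = 1..N. if d dvd l then (if l \<le> k then short_prop d (\<not> b) (N - l) else 0)
        else few_long_bound d k (b = odd l) (N - l))"
proof -
  let ?M = "\<lambda>N. {m \<in> {1..N}. d dvd m \<and> m \<le> k}" and ?L = "\<lambda>N. {l \<in> {1..N}. \<not> d dvd l}"
  have M: "?M (N - l) = {m \<in> ?M N. l + m \<le> N}" for l
    by auto
  have L: "?L (N - m) = {l \<in> ?L N. l + m \<le> N}" for m
    by auto
  have "(\<Sum>l\<in>?L N. few_long_bound d k (b = odd l) (N - l)) =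
    (\<Sum>l\<in>?L N. \<Sum>m\<in>?M (N - l). short_prop d ((\<not> b) = odd l) (N - m - l) / m)"
    unfolding few_long_bound_def by (intro sum.cong refl) (auto simp: add.commute)
  \<comment> \<open>Both orders of summation run over the pairs with
    \<open>l + m \<le> N\<close>.\<close>
  also have "\<dots> = (\<Sum>m\<in>?M N. \<Sum>l\<in>?L (N - m). short_prop d ((\<not> b) = odd l) (N - m - l) / m)"
    unfolding M L by (rule sum.swap_restrict) auto
  also have "\<dots> = (\<Sum>m\<in>?M N. real (N - m) * short_prop d (\<not> b) (N - m) / m)"
    by (simp only: short_prop_rec sum_divide_distrib)
  finally have "(\<Sum>l\<in>?L N. few_long_bound d k (b = odd l) (N - l)) =
    (\<Sum>m\<in>?M N. real (N - m) * short_prop d (\<not> b) (N - m) / m)" .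
  moreover have "(\<Sum>l = 1..N. if d dvd l then (if l \<le> k then short_prop d (\<not> b) (N - l) else 0)
      else few_long_bound d k (b = odd l) (N - l)) =
    (\<Sum>l\<in>?M N. short_prop d (\<not> b) (N - l)) + (\<Sum>l\<in>?L N. few_long_bound d k (b = odd l) (N - l))"
    by (subst (1 2) sum.inter_filter) (auto simp flip: sum.distrib intro!: sum.cong)
  moreover have "real N * (short_prop d (\<not> b) (N - m) / m) =
    short_prop d (\<not> b) (N - m) + real (N - m) * short_prop d (\<not> b) (N - m) / m"
    if "m \<in> ?M N" for m
    using that by (auto simp: field_simps of_nat_diff)
  ultimately show ?thesis
    by (simp add: few_long_bound_def sum_distrib_left sum.distrib)
qed

text \<open>The bound satisfies with equality the recursion that the count satisfies as an
  inequality, so induction on \<open>card A\<close> compares them.\<close>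

lemma card_few_long_perms:
  assumes "d > 1" "even d" "finite A"
  shows "real (card (few_long_perms d k b A)) \<ge> fact (card A) * few_long_bound d k b (card A)"
  using assms(3)
proof (induction "card A" arbitrary: A b rule: less_induct)
  case less
  show ?case
  proof (cases "A = {}")
    case False
    then obtain a where a: "a \<in> A"
      by blast
    let ?N = "card A"
    let ?y = "\<lambda>l. if d dvd l then (if l \<le> k then short_prop d (\<not> b) (?N - l) else 0)
        else few_long_bound d k (b = odd l) (?N - l)"
    have "fact ?N * few_long_bound d k b ?N = fact (?N - 1) * (\<Sum>l = 1..?N. ?y l)"
      using False less.prems
      by (simp only: few_long_bound_rec[symmetric] fact_mult_pred card_gt_0_iff simp_thms)
    also have "\<dots> = (\<Sum>cs\<in>cycles_through a A. fact (?N - length cs) * ?y (length cs))"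
      by (rule sum_cycles_through[OF less.prems a, symmetric])
    also have "\<dots> \<le> (\<Sum>cs\<in>cycles_through a A. real (if d dvd length cs
       then (if length cs \<le> k then card (short_perms d (\<not> b) (A - set cs)) else 0)
       else card (few_long_perms d k (b = odd (length cs)) (A - set cs))))"
    proof (rule sum_mono)
      fix cs assume cs: "cs \<in> cycles_through a A"
      show "fact (?N - length cs) * ?y (length cs) \<le> real (if d dvd length cs
       then (if length cs \<le> k then card (short_perms d (\<not> b) (A - set cs)) else 0)
       else card (few_long_perms d k (b = odd (length cs)) (A - set cs)))"
        using less.hyps[OF card_Diff_cycle(2)[OF less.prems cs]] card_Diff_cycle(1)[OF less.prems cs]
          less.prems card_short_perms[OF assms(1), of "A - set cs" "\<not> b"] by simp
    qed
    also have "\<dots> \<le> real (card (few_long_perms d k b A))"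
      using few_long_perms_by_cycle[OF assms(1,2) less.prems a, of k b]
      unfolding of_nat_sum[symmetric] of_nat_le_iff .
    finally show ?thesis .
  qed (simp add: few_long_bound_def)
qed

section \<open>Numerical estimates\<close>

text \<open>The coefficient of \<open>x ^ N\<close> in \<open>(1 - x ^ d) powr (1 / d) / (1 - x)\<close>.\<close>

definition short_total :: "nat \<Rightarrow> nat \<Rightarrow> real" where
  "short_total d N = (\<Prod>i = 1..N div d. 1 - 1 / (real d * real i))"

lemma short_total_less [simp]: "N < d \<Longrightarrow> short_total d N = 1"
  by (simp add: short_total_def)

lemma short_total_Suc:
  "short_total d (Suc N) = short_total d N * (if d dvd Suc N then 1 - 1 / real (Suc N) else 1)"
proof (cases "d dvd Suc N")
  case True
  then have "Suc N div d = Suc (N div d)"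
    by (simp add: div_Suc dvd_eq_mod_eq_0)
  moreover have "d * Suc (N div d) = Suc N"
    using True calculation by (metis dvd_mult_div_cancel)
  then have "real d * real (Suc (N div d)) = real (Suc N)"
    by (metis of_nat_mult)
  ultimately show ?thesis
    using True by (simp add: short_total_def prod.nat_ivl_Suc' del: of_nat_Suc)
next
  case False
  then show ?thesis
    by (simp add: short_total_def div_Suc dvd_eq_mod_eq_0)
qed

text \<open>This is the difference of the recursion \<open>short_total_rec\<close> at M + d and at
  M. It is proved first, so that the recursion follows by steps of size \<open>d\<close>.\<close>

lemma short_total_shift:
  assumes "d > 1"
  shows "real (M + d) * short_total d (M + d) =
    real M * short_total d M + (\<Sum>i = 1..<d. short_total d (M + i))"
proof (induction M)
  case 0
  obtain d' where "d = Suc d'"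
    using assms by (cases d) auto
  moreover have "short_total d d = 1 - 1 / real d"
    using assms by (simp add: short_total_def)
  ultimately show ?case
    using assms by (simp add: field_simps of_nat_diff)
next
  case (Suc M)
  have "(\<Sum>i = 1..<d. short_total d (Suc M + i)) = (\<Sum>i = Suc 1..<Suc d. short_total d (M + i))"
    by (simp only: sum.shift_bounds_Suc_ivl) simp
  moreover have "(\<Sum>i = 1..<Suc d. short_total d (M + i)) =
      short_total d (M + 1) + (\<Sum>i = Suc 1..<Suc d. short_total d (M + i))"
    using assms by (intro sum.atLeast_Suc_lessThan) auto
  moreover have "(\<Sum>i = 1..<Suc d. short_total d (M + i)) =
      (\<Sum>i = 1..<d. short_total d (M + i)) + short_total d (M + d)"
    using assms by (intro sum.atLeastLessThan_Suc) auto
  ultimately have "(\<Sum>i = 1..<d. short_total d (Suc M + i)) =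
      (\<Sum>i = 1..<d. short_total d (M + i)) + short_total d (M + d) - short_total d (Suc M)"
    by simp
  moreover have step: "real (Suc K) * short_total d (Suc K) =
      real K * short_total d K + short_total d K - (if d dvd Suc K then short_total d K else 0)" for K
    by (cases "d dvd Suc K") (simp_all add: short_total_Suc field_simps)
  have "d dvd Suc (M + d) \<longleftrightarrow> d dvd Suc M"
    by (metis add_Suc dvd_add_left_iff dvd_refl)
  then have "real (Suc M + d) * short_total d (Suc M + d) = real (M + d) * short_total d (M + d) +
      short_total d (M + d) - (if d dvd Suc M then short_total d (M + d) else 0)"
    using step[of "M + d"] by simp
  moreover note step[of M]
  \<comment> \<open>The next multiple of \<open>d\<close> after M + 1 is M + 1 + d, so no new factor
    enters up to M + d.\<close>
  moreover have "short_total d (M + d) = short_total d (Suc M)" if "d dvd Suc M"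
  proof -
    have "(M + d) div d = Suc M div d"
      using that assms by (simp add: div_Suc dvd_eq_mod_eq_0)
    then show ?thesis
      by (simp add: short_total_def)
  qed
  moreover have "short_total d M = short_total d (Suc M)" if "\<not> d dvd Suc M"
    using that by (simp add: short_total_Suc)
  ultimately show ?case
    using Suc by (cases "d dvd Suc M") simp_all
qed

lemma short_total_rec:
  assumes "d > 1"
  shows "real N * short_total d N = (\<Sum>l\<in>{l \<in> {1..N}. \<not> d dvd l}. short_total d (N - l))"
proof (induction N rule: less_induct)
  case (less N)
  show ?case
  proof (cases "N < d")
    case True
    then have "{l \<in> {1..N}. \<not> d dvd l} = {1..N}"
      by (auto dest: dvd_imp_le)
    with True show ?thesis
      by simp
  next
    case False
    define M where "M = N - d"
    have N: "N = M + d"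
      using False by (simp add: M_def)
    \<comment> \<open>No positive l below \<open>d\<close> is a multiple of \<open>d\<close>, and
      the larger admissible l are the admissible ones for \<open>M\<close>, shifted by
      \<open>d\<close>.\<close>
    have split: "{l \<in> {1..N}. \<not> d dvd l} = {1..<d} \<union> (\<lambda>l. l + d) ` {l \<in> {1..M}. \<not> d dvd l}"
    proof (intro equalityI subsetI)
      fix l assume l: "l \<in> {l \<in> {1..N}. \<not> d dvd l}"
      show "l \<in> {1..<d} \<union> (\<lambda>l. l + d) ` {l \<in> {1..M}. \<not> d dvd l}"
      proof (cases "l < d")
        case False
        then obtain l' where "l = l' + d"
          by (metis add.commute le_add_diff_inverse not_less)
        with l show ?thesis
          by (cases "l' = 0") (auto simp: N)
      qed (use l in auto)
    qed (auto simp: N dest: dvd_imp_le)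
    have "(\<Sum>l\<in>{l \<in> {1..N}. \<not> d dvd l}. short_total d (N - l)) =
      (\<Sum>l = 1..<d. short_total d (N - l)) +
      (\<Sum>l\<in>(\<lambda>l. l + d) ` {l \<in> {1..M}. \<not> d dvd l}. short_total d (N - l))"
      unfolding split by (rule sum.union_disjoint) auto
    also have "(\<Sum>l = 1..<d. short_total d (N - l)) = (\<Sum>i = 1..<d. short_total d (M + i))"
      by (rule sum.reindex_bij_witness[of _ "\<lambda>i. d - i" "\<lambda>i. d - i"]) (auto simp: N)
    also have "(\<Sum>l\<in>(\<lambda>l. l + d) ` {l \<in> {1..M}. \<not> d dvd l}. short_total d (N - l)) =
        (\<Sum>l\<in>{l \<in> {1..M}. \<not> d dvd l}. short_total d (M - l))"
      by (subst sum.reindex) (auto simp: N)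
    also have "\<dots> = real M * short_total d M"
      using less[of M] N assms by simp
    finally show ?thesis
      using short_total_shift[OF assms, of M] by (simp add: N)
  qed
qed

section \<open>Distribution of the short permutations over the two parities\<close>

lemma short_prop_total:
  assumes "d > 1"
  shows "short_prop d True N + short_prop d False N = short_total d N"
proof (induction N rule: less_induct)
  case (less N)
  show ?case
  proof (cases "N = 0")
    case False
    have "real N * (short_prop d True N + short_prop d False N) =
      (\<Sum>l\<in>{l \<in> {1..N}. \<not> d dvd l}.
        short_prop d (True = odd l) (N - l) + short_prop d (False = odd l) (N - l))"
      by (simp only: distrib_left short_prop_rec sum.distrib)
    also have "\<dots> = (\<Sum>l\<in>{l \<in> {1..N}. \<not> d dvd l}. short_total d (N - l))"
    proof (rule sum.cong[OF refl])
      fix l assume "l \<in> {l \<in> {1..N}. \<not> d dvd l}"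
      then show "short_prop d (True = odd l) (N - l) + short_prop d (False = odd l) (N - l) =
          short_total d (N - l)"
        using less[of "N - l"] by (cases "odd l") (auto simp: add.commute)
    qed
    also have "\<dots> = real N * short_total d N"
      using short_total_rec[OF assms] by simp
    finally show ?thesis
      using False by simp
  qed (use assms in simp)
qed

lemma short_prop_1:
  assumes "d > 1"
  shows "short_prop d b 1 = of_bool b"
proof -
  have L: "{l \<in> {1..1::nat}. \<not> d dvd l} = {1}"
    using assms by auto
  have "short_prop d b 1 = (\<Sum>l\<in>{1}. short_prop d (b = odd l) (1 - l))"
    using short_prop_rec[of 1 d b] unfolding L by simp
  then show ?thesis
    by simp
qed

text \<open>With \<open>d > 2\<close> neither permutation of two points is excluded, and one of them
  is even, the other odd. The surplus over a quarter is what later offsets a deficit.\<close>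

lemma short_prop_2:
  assumes "d > 2"
  shows "short_prop d b 2 = 1 / 2"
proof -
  have L: "{l \<in> {1..2::nat}. \<not> d dvd l} = {1, 2}"
    using assms by (auto dest: dvd_imp_le)
  have "2 * short_prop d b 2 = (\<Sum>l\<in>{1, 2}. short_prop d (b = odd l) (2 - l))"
    using short_prop_rec[of 2 d b] unfolding L by simp
  also have "\<dots> = 1"
    using assms short_prop_1[of d b] by (cases b) simp_all
  finally show ?thesis
    by simp
qed

text \<open>In the recursion the bound fails only for the terms with \<open>N - l \<le> 1\<close>.  If both occur, exactly one
  of them is \<open>1\<close>; if only one occurs, the term with \<open>N - l = 2\<close> compensates for it.\<close>

lemma short_prop_ge_quarter:
  assumes "d \<ge> 4" "N \<ge> 2"
  shows "short_prop d b N \<ge> short_total d N / 4"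
  using assms(2)
proof (induction N arbitrary: b rule: less_induct)
  case (less N)
  let ?L = "{l \<in> {1..N}. \<not> d dvd l}"
  \<comment> \<open>\<open>D l\<close> is the surplus of the l-th term of the recursion over the
    claimed quarter; the claim is that the surpluses have a nonnegative sum.\<close>
  define D where "D l = short_prop d (b = odd l) (N - l) - short_total d (N - l) / 4" for l
  have pos: "0 \<le> D l" if "l \<in> ?L" "l \<noteq> N" "l \<noteq> N - 1" for l
    using that less(1)[of "N - l" "b = odd l"] by (auto simp: D_def)
  have mono: "sum D S \<le> sum D ?L" if "S \<subseteq> ?L" "\<And>l. l \<in> ?L - S \<Longrightarrow> l \<noteq> N \<and> l \<noteq> N - 1" for S
    using that pos by (intro sum_mono2) auto
  have DN: "D N = of_bool (b = odd N) - 1 / 4"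
    using assms by (simp add: D_def)
  have DN1: "D (N - 1) = of_bool (b = odd (N - 1)) - 1 / 4"
    using assms less.prems short_prop_1[of d] by (simp add: D_def)
  have DN2: "D (N - 2) = 1 / 4"
    using assms less.prems by (simp add: D_def short_prop_2)
  have "0 \<le> sum D ?L"
  proof (cases "d dvd N \<or> d dvd N - 1")
    case False
    then have "sum D {N - 1, N} \<le> sum D ?L"
      using less.prems by (intro mono) auto
    moreover have "odd (N - 1) \<longleftrightarrow> even N"
      using less.prems by (cases N) auto
    ultimately show ?thesis
      using less.prems by (cases b; cases "even N") (auto simp: DN DN1[unfolded One_nat_def])
  next
    case True
    then have N: "N \<ge> 4"
      using assms(1) less.prems by (auto dest: dvd_imp_le)
    have not2: "\<not> d dvd N - 2"
    proof
      assume "d dvd N - 2"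
      then have "d dvd N - (N - 2) \<or> d dvd (N - 1) - (N - 2)"
        using True dvd_diff_nat by blast
      with N assms show False
        by (auto dest: dvd_imp_le)
    qed
    have "d dvd N \<Longrightarrow> d dvd N - 1 \<Longrightarrow> d dvd N - (N - 1)"
      using dvd_diff_nat by blast
    then have notboth: "\<not> (d dvd N \<and> d dvd N - 1)"
      using N assms by auto
    \<comment> \<open>Exactly one of \<open>N\<close> and \<open>N - 1\<close> is a multiple of
      \<open>d\<close> and hence absent from the sum; \<open>x\<close> is the other one.\<close>
    define x where "x = (if d dvd N then N - 1 else N)"
    have "sum D {N - 2, x} \<le> sum D ?L"
      using True not2 notboth N by (intro mono) (auto simp: x_def)
    moreover have "D x \<ge> - 1 / 4"
      by (auto simp: x_def DN DN1[unfolded One_nat_def])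
    moreover have "N - 2 \<noteq> x"
      using N by (auto simp: x_def)
    ultimately show ?thesis
      by (simp add: DN2)
  qed
  then have "real N * (short_total d N / 4) \<le> real N * short_prop d b N"
    using assms short_total_rec[of d N] short_prop_rec[of N d b]
    by (simp add: D_def sum_subtractf sum_divide_distrib)
  with less.prems show ?case
    by simp
qed

section \<open>Lower bound for the proportion without long cycles\<close>

text \<open>By Bernoulli, the d-th power of the factor at i is at least 1 - 1/i, and these bounds
  telescope to 1/t. The factor at i = 1 is kept apart, since Bernoulli would only give 0
  there.\<close>

lemma short_total_power_ge:
  assumes "d > 1" "t \<ge> 1"
  shows "(\<Prod>i = 1..t. 1 - 1 / (real d * real i)) ^ d \<ge> (1 - 1 / real d) ^ d / real t"
  using assms(2)
proof (induction t rule: dec_induct)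
  case (step s)
  let ?x = "1 / (real d * real (Suc s))"
  have "1 * 1 \<le> real d * real (Suc s)"
    using assms by (intro mult_mono) auto
  then have "?x \<le> 1"
    by (simp add: divide_le_eq_1)
  then have "1 + real d * (- ?x) \<le> (1 + (- ?x)) ^ d"
    by (intro Bernoulli_inequality) simp
  moreover have "1 + real d * (- ?x) = 1 - 1 / real (Suc s)"
    using assms by simp
  then have "1 + real d * (- ?x) = real s / real (Suc s)"
    by (simp add: field_simps)
  moreover have "0 \<le> (1 - 1 / real d) ^ d / real s"
    using assms by simp
  then have "0 \<le> (\<Prod>i = 1..s. 1 - 1 / (real d * real i)) ^ d"
    using step.IH by (rule order_trans)
  ultimately have "(1 - 1 / real d) ^ d / real s * (real s / real (Suc s)) \<le>
      (\<Prod>i = 1..s. 1 - 1 / (real d * real i)) ^ d * (1 - ?x) ^ d"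
    using step.IH by (intro mult_mono) auto
  moreover have "(1 - 1 / real d) ^ d / real s * (real s / real (Suc s)) =
      (1 - 1 / real d) ^ d / real (Suc s)"
    using step.hyps by (simp del: of_nat_Suc)
  ultimately show ?case
    by (simp add: prod.nat_ivl_Suc' power_mult_distrib mult.commute)
qed simp

text \<open>Since t \<le> n \<le> exp d \<le> 3 ^ d, the d-th power of
  \<open>short_total d N\<close> is at least (3/4) ^ d / 3 ^ d = (1/4) ^ d.\<close>

lemma short_total_ge_quarter:
  assumes "d \<ge> 4" "ln (real n) \<le> real d" "N \<le> n"
  shows "short_total d N \<ge> 1 / 4"
proof (cases "N div d = 0")
  case False
  define t where "t = N div d"
  have t: "t \<ge> 1" "t \<le> n"
    using False order_trans[OF div_le_dividend assms(3)] by (auto simp: t_def)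
  have "real t \<le> real n"
    using t by simp
  also have "\<dots> = exp (ln (real n))"
    using t by simp
  also have "\<dots> \<le> exp (real d * 1)"
    using assms by simp
  also have "\<dots> = exp 1 ^ d"
    by (rule exp_of_nat_mult)
  also have "\<dots> \<le> 3 ^ d"
    using exp_le by (intro power_mono) auto
  finally have t3: "real t \<le> 3 ^ d" .
  have "(1 / 4 :: real) ^ d = (3 / 4) ^ d / 3 ^ d"
    by (simp flip: power_divide)
  also have "\<dots> \<le> (1 - 1 / real d) ^ d / real t"
    using t t3 assms(1) by (intro frac_le power_mono) (auto simp: field_simps)
  also have "\<dots> \<le> short_total d N ^ d"
    using short_total_power_ge[of d t] t assms by (simp add: short_total_def t_def)
  finally have "(1 / 4) ^ Suc (d - 1) \<le> short_total d N ^ Suc (d - 1)"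
    using assms by simp
  moreover have "0 \<le> short_total d N"
    unfolding short_total_def
  proof (rule prod_nonneg)
    fix i assume "i \<in> {1..N div d}"
    then have "1 * 1 \<le> real d * real i"
      using assms(1) by (intro mult_mono) auto
    then show "0 \<le> 1 - 1 / (real d * real i)"
      by simp
  qed
  ultimately show ?thesis
    by (rule power_le_imp_le_base)
qed (simp add: short_total_def)

section \<open>Harmonic sums over the multiples of \<open>d\<close>\<close>

lemma ln_le_sum_inverse: "ln (real J + 1) \<le> (\<Sum>j = 1..J. 1 / real j)"
proof (induction J)
  case (Suc J)
  have "ln (real (Suc J) + 1) = ln (real J + 1) + ln (1 + 1 / real (Suc J))"
  proof -
    have "real (Suc J) + 1 = (real J + 1) * (1 + 1 / real (Suc J))"
      by (simp add: field_simps)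
    then show ?thesis
      by (simp add: ln_mult_pos add_pos_nonneg)
  qed
  moreover have "ln (1 + 1 / real (Suc J)) \<le> 1 / real (Suc J)"
    by (rule ln_add_one_self_le_self) simp
  ultimately show ?case
    using Suc by simp
qed simp

lemma sum_inverse_multiples:
  assumes "d > 0" "k \<le> n"
  shows "(\<Sum>m\<in>{m \<in> {1..n}. d dvd m \<and> m \<le> k}. 1 / real m) = (\<Sum>j = 1..k div d. 1 / real j) / real d"
proof -
  have "(\<Sum>m\<in>{m \<in> {1..n}. d dvd m \<and> m \<le> k}. 1 / real m) =
    (\<Sum>j = 1..k div d. 1 / real (d * j))"
    using assms
    by (intro sum.reindex_bij_witness[of _ "\<lambda>j. d * j" "\<lambda>m. m div d"])
       (auto simp: div_le_mono Suc_le_eq div_greater_zero_iff dvd_imp_le less_eq_div_iff_mult_less_eq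
         mult.commute)
  then show ?thesis
    by (simp add: sum_divide_distrib mult.commute)
qed

lemma sum_inverse_multiples_ge:
  assumes "d > 0" "k > 0" "k \<le> n"
  shows "(\<Sum>m\<in>{m \<in> {1..n}. d dvd m \<and> m \<le> k}. 1 / real m) \<ge> ln (real k / real d) / real d"
proof -
  \<comment> \<open>The summand 1 in \<open>ln_le_sum_inverse\<close> absorbs the rounding in
    \<open>k div d\<close>.\<close>
  have "k < d * (k div d + 1)"
    using assms(1) by (metis Suc_eq_plus1 dividend_less_times_div mult_Suc_right add.commute)
  then have "real k < real d * (real (k div d) + 1)"
    by (metis of_nat_1 of_nat_add of_nat_less_iff of_nat_mult)
  then have "ln (real k / real d) \<le> ln (real (k div d) + 1)"
    using assms by (subst ln_le_cancel_iff) (auto simp: field_simps)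
  also have "\<dots> \<le> (\<Sum>j = 1..k div d. 1 / real j)"
    by (rule ln_le_sum_inverse)
  finally show ?thesis
    unfolding sum_inverse_multiples[OF assms(1,3)] by (rule divide_right_mono) simp
qed

text \<open>The factor 1/16 is a quarter from \<open>short_total\<close> times a quarter for the
  prescribed parity. Adding both parities avoids the second loss. The hypothesis
  \<open>k + 2 \<le> n\<close> leaves at least two points off the long cycle, as the parity bound
  requires.\<close>

lemma few_long_bound_ge:
  assumes "d \<ge> 4" "ln (real n) \<le> real d" "k > 0" "k + 2 \<le> n"
  shows "few_long_bound d k b n \<ge> ln (real k / real d) / (16 * real d)"
    and "few_long_bound d k True n + few_long_bound d k False n \<ge> ln (real k / real d) / (4 * real d)"
proof -
  let ?M = "{m \<in> {1..n}. d dvd m \<and> m \<le> k}"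
  have S: "ln (real k / real d) / real d \<le> (\<Sum>m\<in>?M. 1 / real m)"
    using assms by (intro sum_inverse_multiples_ge) auto
  have "ln (real k / real d) / (16 * real d) = ln (real k / real d) / real d * (1 / 16)"
    by simp
  also have "\<dots> \<le> (\<Sum>m\<in>?M. 1 / real m) * (1 / 16)"
    using S by (rule mult_right_mono) simp
  also have "\<dots> \<le> few_long_bound d k b n"
    unfolding few_long_bound_def sum_distrib_right
  proof (rule sum_mono)
    fix m assume m: "m \<in> ?M"
    then have "n - m \<ge> 2"
      using assms by auto
    then have "1 / 16 \<le> short_prop d (\<not> b) (n - m)" "m > 0"
      using short_prop_ge_quarter[of d "n - m" "\<not> b"] short_total_ge_quarter[of d n "n - m"] assms m
      by auto
    then show "1 / real m * (1 / 16) \<le> short_prop d (\<not> b) (n - m) / real m"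
      by (simp add: field_simps)
  qed
  finally show "few_long_bound d k b n \<ge> ln (real k / real d) / (16 * real d)" .
  have "ln (real k / real d) / (4 * real d) = ln (real k / real d) / real d * (1 / 4)"
    by simp
  also have "\<dots> \<le> (\<Sum>m\<in>?M. 1 / real m) * (1 / 4)"
    using S by (rule mult_right_mono) simp
  also have "\<dots> \<le> (\<Sum>m\<in>?M. short_total d (n - m) / real m)"
    unfolding sum_distrib_right
  proof (rule sum_mono)
    fix m assume "m \<in> ?M"
    then have "1 / 4 \<le> short_total d (n - m)" "m > 0"
      using short_total_ge_quarter[of d n "n - m"] assms by auto
    then show "1 / real m * (1 / 4) \<le> short_total d (n - m) / real m"
      by (simp add: field_simps)
  qed
  also have "\<dots> = few_long_bound d k True n + few_long_bound d k False n"
    using assms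
    by (simp add: few_long_bound_def short_prop_total[symmetric] sum.distrib add_divide_distrib)
  finally show "few_long_bound d k True n + few_long_bound d k False n \<ge>
    ln (real k / real d) / (4 * real d)" .
qed

section \<open>Powering to an involution\<close>

text \<open>A point moved by the half power lies on a cycle whose length has odd cofactor in the
  order of \<open>p\<close>. That length contains the full power of 2 in the order, in particular
  \<open>2 ^ a\<close>. Leaving \<open>G\<close> abstract covers the symmetric and alternating
  groups at once.\<close>

lemma powers_to_small_involutionI:
  assumes G: "group G" "mult G = (\<circ>)" "one G = id" "finite (carrier G)"
    and p: "p \<in> carrier G" "permutation p"
    and long: "long_points (2 ^ a) p \<noteq> {}" "finite (long_points (2 ^ a) p)"
      "card (long_points (2 ^ a) p) \<le> k"
    and a: "a > 0"
  shows "powers_to_small_involution G (int k) p"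
proof -
  interpret group G by fact
  define o' where "o' = ord p"
  have pow: "p [^]\<^bsub>G\<^esub> (i::nat) = p ^^ i" for i
    by (induction i) (simp_all add: G funpow_Suc_right del: funpow.simps)
  have dvd_o: "least_power p x dvd o'" for x
    using pow_ord_eq_1[OF p(1)] by (simp add: least_power_dvd[OF p(2)] pow G o'_def)
  have pos: "o' > 0"
    using ord_ge_1[OF G(4) p(1)] by (simp add: o'_def)
  have d_dvd: "2 ^ a dvd o'"
    using long(1) dvd_o dvd_trans by (auto simp: long_points_def)
  then have even: "even o'"
    using a by (meson dvd_power dvd_trans)
  have half: "o' div 2 \<noteq> 0" "o' div 2 dvd o'"
    using pos even by auto
  have "ord (p [^]\<^bsub>G\<^esub> (o' div 2)) = 2"
    using ord_pow[OF p(1), of "o' div 2"] half even by (auto simp: o'_def)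
  then have inv: "involution G (p [^]\<^bsub>G\<^esub> (o' div 2))"
    by (simp add: involution_def p)
  have "perm_support (p ^^ (o' div 2)) \<subseteq> long_points (2 ^ a) p"
  proof
    fix x assume "x \<in> perm_support (p ^^ (o' div 2))"
    then have not_dvd: "\<not> least_power p x dvd o' div 2"
      by (simp add: perm_support_def least_power_dvd[OF p(2)])
    obtain q where q: "o' = least_power p x * q"
      using dvd_o[of x] by (elim dvdE)
    \<comment> \<open>For even \<open>q\<close> the cycle length would divide
      \<open>o' div 2\<close>, and \<open>x\<close> would be fixed.\<close>
    have "odd q"
      using not_dvd q by (auto elim!: evenE)
    then have "coprime (2 ^ a) q"
      by simp
    then have "2 ^ a dvd least_power p x"
      using d_dvd by (simp add: q coprime_dvd_mult_left_iff)
    then show "x \<in> long_points (2 ^ a) p"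
      by (simp add: long_points_def)
  qed
  then have "card (perm_support (p ^^ (o' div 2))) \<le> k"
    using card_mono[OF long(2)] long(3) by (meson order_trans)
  with even inv show ?thesis
    by (simp add: powers_to_small_involution_def pow o'_def)
qed

lemma few_long_perms_powers_to_small_involution:
  assumes "p \<in> few_long_perms (2 ^ a) k b {1..n}" "a > 0"
  shows "p \<in> carrier (sym_group n)" "powers_to_small_involution (sym_group n) (int k) p"
    and "b \<Longrightarrow> p \<in> carrier (alt_group n)" "b \<Longrightarrow> powers_to_small_involution (alt_group n) (int k) p"
proof -
  have p: "p permutes {1..n}" "long_points (2 ^ a) p \<noteq> {}" "card (long_points (2 ^ a) p) \<le> k"
      "evenperm p = b"
    using assms(1) by (auto simp: few_long_perms_def)
  have "(2::nat) ^ a > 1"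
    using assms(2) by (intro one_less_power) auto
  then have fin: "finite (long_points (2 ^ a) p)"
    using long_points_subset[OF _ p(1)] by (blast intro: finite_subset)
  have perm: "permutation p"
    using p(1) permutes_imp_permutation by blast
  have sym: "finite (carrier (sym_group n))"
    by (simp add: sym_group_def finite_permutations)
  then have alt: "finite (carrier (alt_group n))"
    by (rule rev_finite_subset) (auto simp: alt_group_carrier sym_group_carrier)
  show s: "p \<in> carrier (sym_group n)"
    using p by (simp add: sym_group_carrier)
  show "powers_to_small_involution (sym_group n) (int k) p"
    by (rule powers_to_small_involutionI[OF sym_group_is_group sym_group_mult sym_group_one sym s
        perm p(2) fin p(3) assms(2)])
  assume b
  then show c: "p \<in> carrier (alt_group n)"
    using p by (simp add: alt_group_carrier)
  show "powers_to_small_involution (alt_group n) (int k) p"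
    by (rule powers_to_small_involutionI[OF alt_group_is_group alt_group_mult alt_group_one alt c
        perm p(2) fin p(3) assms(2)])
qed

section \<open>From counts to proportions\<close>

lemma p_sym_ge:
  assumes "a > 0" "int k = \<lceil>real n powr \<epsilon>\<rceil>"
  shows "p_sym n \<epsilon> \<ge> few_long_bound (2 ^ a) k True n + few_long_bound (2 ^ a) k False n"
proof -
  let ?F = "\<lambda>b. few_long_perms (2 ^ a) k b {1..n}"
  let ?G = "{p \<in> carrier (sym_group n). powers_to_small_involution (sym_group n) (int k) p}"
  have fin: "finite ?G"
    by (simp add: sym_group_def finite_permutations)
  have sub: "?F True \<union> ?F False \<subseteq> ?G"
    using few_long_perms_powers_to_small_involution[OF _ assms(1)] by blast
  have "(2::nat) ^ a > 1"
    using assms(1) by (intro one_less_power) auto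
  then have "real (card (?F b)) \<ge> fact n * few_long_bound (2 ^ a) k b n" for b
    using card_few_long_perms[of "2 ^ a" "{1..n}" k b] assms(1) by (simp del: One_nat_def)
  then have "fact n * (few_long_bound (2 ^ a) k True n + few_long_bound (2 ^ a) k False n) \<le>
      real (card (?F True) + card (?F False))"
    unfolding distrib_left of_nat_add by (intro add_mono)
  also have "card (?F True) + card (?F False) = card (?F True \<union> ?F False)"
    using fin sub by (intro card_Un_disjoint[symmetric]) (auto simp: few_long_perms_def intro: finite_subset)
  also have "real (card (?F True \<union> ?F False)) \<le> real (card ?G)"
    using card_mono[OF fin sub] by simp
  finally show ?thesis
    by (simp add: p_sym_def proportion_def order_def sym_group_card_carrier assms(2) field_simps)
qed

text \<open>The factor 2 comes from dividing by \<open>fact n / 2\<close>, the order of the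
  alternating group for \<open>n \<ge> 2\<close>.\<close>

lemma p_alt_ge:
  assumes "a > 0" "int k = \<lceil>real n powr \<epsilon>\<rceil>" "n \<ge> 2"
  shows "p_alt n \<epsilon> \<ge> 2 * few_long_bound (2 ^ a) k True n"
proof -
  let ?F = "few_long_perms (2 ^ a) k True {1..n}"
  let ?G = "{p \<in> carrier (alt_group n). powers_to_small_involution (alt_group n) (int k) p}"
  have fin: "finite ?G"
    by (rule finite_subset[of _ "{p. p permutes {1..n}}"])
       (auto simp: alt_group_carrier finite_permutations)
  have sub: "?F \<subseteq> ?G"
    using few_long_perms_powers_to_small_involution[OF _ assms(1)] by blast
  have "(2::nat) ^ a > 1"
    using assms(1) by (intro one_less_power) auto
  then have "fact n * few_long_bound (2 ^ a) k True n \<le> real (card ?F)"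
    using card_few_long_perms[of "2 ^ a" "{1..n}" k True] assms(1) by (simp del: One_nat_def)
  also have "\<dots> \<le> real (card ?G)"
    using card_mono[OF fin sub] by simp
  finally have le: "fact n * few_long_bound (2 ^ a) k True n \<le> real (card ?G)" .
  have order: "2 * real (order (alt_group n)) = fact n"
    unfolding order_def using alt_group_card_carrier[OF assms(3)]
    by (metis of_nat_fact of_nat_mult of_nat_numeral)
  have "real (order (alt_group n)) > 0"
    using order fact_gt_zero[of n, where 'a = real] by linarith
  with le order[symmetric] show ?thesis
    by (simp add: p_alt_def proportion_def assms(2) field_simps)
qed

section \<open>Logarithmic inequalities and the choice of \<open>d\<close>\<close>

lemma ln_gt_2I:
  assumes "n > 0" "(ln (real n) + 1)\<^sup>2 + 2 * ln (real n) < real n"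
  shows "ln (real n) > 2"
proof -
  define L where "L = ln (real n)"
  have ln3: "ln 3 \<ge> (1 :: real)"
    using exp_le by (subst ln_ge_iff) auto
  have "ln 3 < ln (2\<^sup>2 :: real)"
    by (subst ln_less_cancel_iff) auto
  also have "ln (2\<^sup>2 :: real) = 2 * ln 2"
    by (simp only: ln_realpow zero_less_numeral of_nat_numeral)
  finally have ln2: "ln 2 > (1 / 2 :: real)"
    using ln3 by simp
  have ln6: "ln 6 = ln 2 + (ln 3 :: real)" and ln9: "ln 9 = 2 * (ln 3 :: real)"
    and ln12: "ln 12 = 2 * ln 2 + (ln 3 :: real)"
    using ln_mult_pos[of 2 "3 :: real"] ln_realpow[of 3 2] ln_realpow[of 2 2]
      ln_mult_pos[of "2\<^sup>2" "3 :: real"] by simp_all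
  have "ln (real m) \<le> L" if "m \<le> n" "m > 0" for m
    using that by (simp add: L_def)
  from this[of 2] this[of 3] this[of 6] this[of 9] this[of 12]
  have L: "n \<ge> 2 \<Longrightarrow> L > 1 / 2" "n \<ge> 3 \<Longrightarrow> L \<ge> 1" "n \<ge> 6 \<Longrightarrow> L \<ge> 3 / 2"
    "n \<ge> 9 \<Longrightarrow> L \<ge> 2" "n \<ge> 12 \<Longrightarrow> L > 2"
    using ln2 ln3 ln6 ln9 ln12 by simp_all
  have bound: "L\<^sup>2 + 4 * L + 1 < real n"
    using assms(2) by (simp add: L_def power2_sum)
  have sq: "L\<^sup>2 \<ge> 0"
    by simp
  \<comment> \<open>On each range below 12, the value of L\<le>ln n at the left end is too large for
    \<open>bound\<close> even at the right end; the rough values ln 2 > 1/2 and ln 3 \<ge> 1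
    suffice.\<close>
  have "n \<ge> 12"
  proof (rule ccontr)
    assume "\<not> 12 \<le> n"
    with assms(1) consider "n = 1" | "n = 2" | "3 \<le> n" "n \<le> 5" | "6 \<le> n" "n \<le> 8" | "9 \<le> n" "n \<le> 11"
      by linarith
    then show False
    proof cases
      case 1
      with bound show ?thesis
        by (simp add: L_def)
    next
      case 4
      then have "L\<^sup>2 \<ge> 9 / 4"
        using power_mono[of "3 / 2" L 2] L(3) by (simp add: power_divide)
      with 4 bound L(3) show ?thesis
        by linarith
    next
      case 5
      then have "L\<^sup>2 \<ge> 4"
        using power_mono[of 2 L 2] L(4) by simp
      with 5 bound L(4) show ?thesis
        by linarith
    qed (use bound sq L(1,2) in linarith)+
  qed
  then show ?thesis
    using L(5) by (simp add: L_def)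
qed

lemma power_2_between:
  fixes L :: real
  assumes "L > 1"
  obtains a where "a > 0" "L \<le> 2 ^ a" "2 ^ a < 2 * L"
proof -
  define a where "a = (LEAST a. L \<le> 2 ^ a)"
  obtain a0 where "L < 2 ^ a0"
    using real_arch_pow[of 2 L] by auto
  then have a: "L \<le> 2 ^ a"
    unfolding a_def by (intro LeastI[of "\<lambda>a. L \<le> 2 ^ a" a0]) simp
  then have "a > 0"
    using assms by (cases a) auto
  \<comment> \<open>Minimality of \<open>a\<close> gives the upper bound; \<open>L > 1\<close> has
    excluded \<open>a = 0\<close>.\<close>
  then have "\<not> L \<le> 2 ^ (a - 1)"
    unfolding a_def by (intro not_less_Least) simp
  then have "2 ^ a < 2 * L"
    using \<open>a > 0\<close> by (cases a) auto
  with a \<open>a > 0\<close> show thesis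
    by (intro that)
qed

theorem theorem1p1:
  fixes \<epsilon> :: real and n :: nat
  assumes "0 < \<epsilon>" and "\<epsilon> < 1"
    and "n > 0"
    and "\<lceil>(ln (real n) + 1)\<^sup>2\<rceil> < \<lceil>real n powr \<epsilon>\<rceil>"
    and "\<lceil>real n powr \<epsilon>\<rceil> \<le> int n - 2 * \<lceil>ln (real n)\<rceil>"
  shows "p_sym n \<epsilon> > \<epsilon> / 48 \<and> p_alt n \<epsilon> > \<epsilon> / 96"
proof -
  define L where "L = ln (real n)"
  define k where "k = nat \<lceil>real n powr \<epsilon>\<rceil>"
  have L0: "L \<ge> 0"
    using assms(3) by (simp add: L_def)
  \<comment> \<open>A strict inequality between the ceilings is at least as strong as one between
    the numbers.\<close>
  have sq: "(L + 1)\<^sup>2 < real n powr \<epsilon>"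
    using assms(4) le_of_int_ceiling[of "(L + 1)\<^sup>2"] unfolding L_def less_ceiling_iff by linarith
  have k: "int k = \<lceil>real n powr \<epsilon>\<rceil>"
    by (simp add: k_def order_less_le_trans[OF _ powr_ge_zero])
  have k_ge: "real n powr \<epsilon> \<le> real k"
    using le_of_int_ceiling[of "real n powr \<epsilon>"] by (simp flip: k)
  have k_le: "int k \<le> int n - 2 * \<lceil>L\<rceil>"
    using assms(5) by (simp add: k L_def)
  then have "real k \<le> real n - 2 * real_of_int \<lceil>L\<rceil>"
    by linarith
  then have "real k + 2 * L \<le> real n"
    using le_of_int_ceiling[of L] by linarith
  \<comment> \<open>The two hypotheses combine to (L + 1)^2 + 2 L < n, which rules out small
    n.\<close>
  then have L2: "L > 2"
    unfolding L_def using sq k_ge assms(3) by (intro ln_gt_2I) (auto simp: L_def)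
  have "\<lceil>L\<rceil> \<ge> 1"
    using L2 by simp
  with k_le have k2: "k + 2 \<le> n"
    by linarith
  obtain a where a: "a > 0" "L \<le> 2 ^ a" "2 ^ a < 2 * L"
    using power_2_between[of L] L2 by auto
  have "a \<noteq> 1"
    using a L2 by auto
  with a(1) have "(2::nat) ^ 2 \<le> 2 ^ a"
    by (intro power_increasing) auto
  then have d4: "(2::nat) ^ a \<ge> 4"
    by simp
  have k0: "k > 0"
    using sq k_ge zero_le_power2[of "L + 1"] by (cases k) auto
  have "ln ((L + 1)\<^sup>2) < ln (real n powr \<epsilon>)"
    using sq L0 by (subst ln_less_cancel_iff) (auto simp: assms)
  then have lnL: "2 * ln (L + 1) < \<epsilon> * L"
    using L0 assms(3) by (simp add: ln_powr ln_realpow L_def)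
  have "ln (real n powr \<epsilon>) \<le> ln (real k)"
    using k_ge assms(3) k0 by (subst ln_le_cancel_iff) auto
  then have lnk: "\<epsilon> * L \<le> ln (real k)"
    using assms(3) by (simp add: ln_powr L_def)
  have "ln (2 ^ a) \<le> ln (2 * (L + 1))"
    using a L0 by (subst ln_le_cancel_iff) auto
  also have "\<dots> = ln 2 + ln (L + 1)"
    using L0 by (intro ln_mult_pos) auto
  finally have lnd: "ln (2 ^ a) \<le> ln 2 + ln (L + 1)" .
  have "3 * ln 2 = ln ((2::real) ^ 3)"
    by (simp only: ln_realpow zero_less_numeral of_nat_numeral)
  also have "\<dots> \<le> ln (3 ^ 2)"
    by (subst ln_le_cancel_iff) auto
  also have "\<dots> = 2 * ln 3"
    by (simp only: ln_realpow zero_less_numeral of_nat_numeral)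
  also have "\<dots> \<le> 2 * ln (L + 1)"
    using L2 by simp
  finally have "3 * ln 2 \<le> 2 * ln (L + 1)" .
  \<comment> \<open>From 8 \<le> 9 and L > 2, ln 2 is at most 2/3 of ln (L + 1). So ln d \<le> 5/3
    ln (L + 1) < 5/6 \<epsilon> L for d = 2 ^ a, which leaves a sixth of \<epsilon> L.\<close>
  with lnL lnk lnd have "\<epsilon> * L / 6 \<le> ln (real k) - ln (2 ^ a)"
    by linarith
  then have ratio: "\<epsilon> * L / 6 \<le> ln (real k / real (2 ^ a))"
    using k0 by (simp add: ln_div)
  have "\<epsilon> / 12 = \<epsilon> * L / 6 / (2 * L)"
    using L2 by simp
  also have "\<dots> < \<epsilon> * L / 6 / real (2 ^ a)"
    using a L2 assms(1) by (intro divide_strict_left_mono) auto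
  also have "\<dots> \<le> ln (real k / real (2 ^ a)) / real (2 ^ a)"
    using ratio by (rule divide_right_mono) simp
  finally have main: "\<epsilon> / 12 < ln (real k / real (2 ^ a)) / real (2 ^ a)" .
  have "ln (real n) \<le> real (2 ^ a)"
    using a by (simp add: L_def)
  note bounds = few_long_bound_ge[OF d4 this k0 k2]
  \<comment> \<open>The constants are 48 = 12 * 4 for the symmetric group and 96 = 12 * 16 / 2 for
    the alternating group.\<close>
  have "ln (real k / real (2 ^ a)) / (4 * real (2 ^ a)) = ln (real k / real (2 ^ a)) / real (2 ^ a) / 4"
    "ln (real k / real (2 ^ a)) / (16 * real (2 ^ a)) = ln (real k / real (2 ^ a)) / real (2 ^ a) / 16"
    by simp_all
  with main bounds(1)[of True] bounds(2) p_sym_ge[OF a(1) k] p_alt_ge[OF a(1) k] k2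
  show ?thesis
    by linarith
qed

end
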